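(* For every integer $n\ge 1$, $|\mathcal{S}_n(31;\,2\to 1)| = B_n$, where $B_n$ is the $n$-th Bell number.
   Context: $[n]=\{1,\dots,n\}$, and $\mathcal{S}_n$ is the set of permutations $\pi=\pi_1\pi_2\cdots\pi_n$ of $[n]$ in one-line notation. The permutation $\hat\pi$: for $\pi\in\mathcal{S}_n$, $\hat\pi\in\mathcal{S}_n$ is the permutation whose cycle form is obtained from the word $\pi_1\cdots\pi_n$ by inserting a left parenthesis before each left-to-right maximum (an entry larger than all entries to its left) and a right parenthesis immediately before the next left-to-right maximum, or at the end of the word. A cycle $(c_1,c_2,\dots,c_s)$ means $c_1\mapsto c_2\mapsto\cdots\mapsto c_s\mapsto c_1$. Example: if $\pi=2537164$ then $\hat\pi=(2)(53)(7164)$. Arrow patterns: an arrow pattern of size $k$ is a pair $(\nu;H)$ where $\nu=\nu_1\cdots\nu_m$ is a word of distinct positive integers, $H$ is a collection of arrows $b_i\to c_i$, and the set of all integers appearing in $\nu$ or $H$ is $[k]$. A permutation $\pi\in\mathcal{S}_n$ contains $(\nu;H)$ if there are a set $X=\{x_1<x_2<\cdots<x_k\}\subseteq[n]$ and indices $t_1<\cdots<t_m$ such that $\pi_{t_1}\pi_{t_2}\cdots\pi_{t_m}=x_{\nu_1}x_{\nu_2}\cdots x_{\nu_m}$ and $\hat\pi(x_{b_i})=x_{c_i}$ for every arrow $b_i\to c_i$ in $H$. Otherwise $\pi$ avoids $(\nu;H)$. $\mathcal{S}_n(\nu;H)$ is the set of permutations in $\mathcal{S}_n$ avoiding $(\nu;H)$.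 The Bell number $B_n$ is the number of set partitions of $[n]$. *)

theory Defs
  imports "HOL-Library.Disjoint_Sets" "HOL-Combinatorics.Combinatorics"
begin

text \<open>
  A permutation of \<open>{1..n}\<close> in one-line notation is a list in \<^term>\<open>permutations_of_set {1..n}\<close>.
  List positions are counted from 0, the entries are \<open>1, \<dots>, n\<close>.
\<close>

section \<open>The permutation obtained by cutting a word at its left-to-right maxima\<close>

definition ltr_max :: "nat list \<Rightarrow> nat \<Rightarrow> bool" where
  "ltr_max w y \<longleftrightarrow> (\<exists>us vs. w = us @ y # vs \<and> (\<forall>u\<in>set us. u < y))"

text \<open>
  A block that starts at a left-to-right maximum \<open>x\<close> extends up to the first later entry
  that exceeds \<open>x\<close>, which is the next left-to-right maximum.  The lemmas below confirm that the
  blocks make up the word and that they begin exactly at its left-to-right maxima.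
\<close>

function ltr_blocks :: "nat list \<Rightarrow> nat list list" where
  "ltr_blocks [] = []"
| "ltr_blocks (x # xs) =
     (x # takeWhile (\<lambda>y. y < x) xs) # ltr_blocks (dropWhile (\<lambda>y. y < x) xs)"
  by pat_completeness auto
termination
  by (relation "measure length") (simp_all add: length_dropWhile_le less_Suc_eq_le)

lemma concat_ltr_blocks: "concat (ltr_blocks w) = w"
  by (induction w rule: ltr_blocks.induct) simp_all

lemma ltr_blocks_nonempty: "[] \<notin> set (ltr_blocks w)"
  by (induction w rule: ltr_blocks.induct) simp_all

lemma ltr_max_Cons:
  assumes "distinct (x # xs)"
  shows "ltr_max (x # xs) y \<longleftrightarrow> y = x \<or> ltr_max (dropWhile (\<lambda>y. y < x) xs) y"
proof
  assume "ltr_max (x # xs) y"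
  then obtain us vs where w: "x # xs = us @ y # vs" and lt: "\<forall>u\<in>set us. u < y"
    unfolding ltr_max_def by blast
  show "y = x \<or> ltr_max (dropWhile (\<lambda>y. y < x) xs) y"
  proof (cases us)
    case Nil
    with w show ?thesis by simp
  next
    case (Cons a us')
    with w lt have xs: "xs = us' @ y # vs" and "x < y" and lt': "\<forall>u\<in>set us'. u < y" by auto
    have "dropWhile (\<lambda>y. y < x) xs = dropWhile (\<lambda>y. y < x) us' @ y # vs"
      unfolding xs using \<open>x < y\<close> by (induction us') auto
    moreover have "\<forall>u\<in>set (dropWhile (\<lambda>y. y < x) us'). u < y"
      using lt' by (auto dest: set_dropWhileD)
    ultimately show ?thesis unfolding ltr_max_def by blast
  qed
next
  assume "y = x \<or> ltr_max (dropWhile (\<lambda>y. y < x) xs) y"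
  then show "ltr_max (x # xs) y"
  proof
    assume "y = x"
    then show ?thesis unfolding ltr_max_def by (intro exI[of _ "[]"] exI[of _ xs]) simp
  next
    assume "ltr_max (dropWhile (\<lambda>y. y < x) xs) y"
    then obtain us vs where d: "dropWhile (\<lambda>y. y < x) xs = us @ y # vs"
      and lt: "\<forall>u\<in>set us. u < y" unfolding ltr_max_def by blast
    let ?A = "takeWhile (\<lambda>y. y < x) xs"
    have xs: "xs = ?A @ us @ y # vs" using d by (metis takeWhile_dropWhile_id)
    have "y \<in> set (dropWhile (\<lambda>y. y < x) xs)" unfolding d by simp
    then have "y \<in> set xs" by (rule set_dropWhileD)
    then have "y \<noteq> x" using assms by auto
    have "\<not> hd (us @ y # vs) < x"
      using hd_dropWhile[of "\<lambda>y. y < x" xs] d by simp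
    then have "x < y" using lt \<open>y \<noteq> x\<close> by (cases us) auto
    moreover have "\<forall>u\<in>set ?A. u < x" by (auto dest: set_takeWhileD)
    ultimately have "\<forall>u\<in>set (x # ?A @ us). u < y" using lt by auto
    moreover have "x # xs = (x # ?A @ us) @ y # vs" using xs by simp
    ultimately show ?thesis unfolding ltr_max_def by blast
  qed
qed

lemma hd_ltr_blocks: "distinct w \<Longrightarrow> hd ` set (ltr_blocks w) = {y. ltr_max w y}"
proof (induction w rule: ltr_blocks.induct)
  case 1
  then show ?case by (simp add: ltr_max_def)
next
  case (2 x xs)
  then show ?case using ltr_max_Cons[OF 2(2)] by (auto simp: distinct_dropWhile)
qed

text \<open>
  \<^term>\<open>cycle_of_list [c\<^sub>1, c\<^sub>2, c\<^sub>3]\<close> maps \<open>c\<^sub>1\<close> to \<open>c\<^sub>2\<close>, \<open>c\<^sub>2\<close> to \<open>c\<^sub>3\<close> and \<open>c\<^sub>3\<close> to \<open>c\<^sub>1\<close>.  The cycles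
  multiplied here are disjoint, so their order does not matter.
\<close>

definition hat_perm :: "nat list \<Rightarrow> nat \<Rightarrow> nat" where
  "hat_perm w = foldr (\<circ>) (map cycle_of_list (ltr_blocks w)) id"

lemma "ltr_blocks [2,5,3,7,1,6,4] = [[2], [5,3], [7,1,6,4]]"
  by simp

lemma "map (hat_perm [2,5,3,7,1,6,4]) [1,2,3,4,5,6,7] = [6,2,5,7,3,4,1]"
  by (simp add: hat_perm_def transpose_def)

section \<open>Arrow patterns\<close>

text \<open>A pair \<open>(b, c)\<close> in the second component is the arrow \<open>b \<rightarrow> c\<close>.\<close>

type_synonym arrow_pattern = "nat list \<times> (nat \<times> nat) set"

definition pattern_letters :: "arrow_pattern \<Rightarrow> nat set" where
  "pattern_letters = (\<lambda>(\<nu>, H). set \<nu> \<union> fst ` H \<union> snd ` H)"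

definition is_arrow_pattern :: "nat \<Rightarrow> arrow_pattern \<Rightarrow> bool" where
  "is_arrow_pattern k p \<longleftrightarrow> distinct (fst p) \<and> pattern_letters p = {1..k}"

text \<open>
  \<open>k\<close> is the size of the pattern, \<open>x\<close> enumerates \<open>X = {x 1 < \<dots> < x k}\<close>,
  and \<open>t\<close> gives the (zero-based) positions of the occurrence of \<open>\<nu>\<close>.
\<close>

definition contains_arrow :: "nat list \<Rightarrow> arrow_pattern \<Rightarrow> bool" where
  "contains_arrow \<pi> = (\<lambda>(\<nu>, H). let k = card (pattern_letters (\<nu>, H)); m = length \<nu> in
     (\<exists>x t. strict_mono_on {1..k} x \<and> x ` {1..k} \<subseteq> {1..length \<pi>} \<and>
            strict_mono_on {..<m} t \<and> t ` {..<m} \<subseteq> {..<length \<pi>} \<and>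
            (\<forall>j<m. \<pi> ! t j = x (\<nu> ! j)) \<and>
            (\<forall>(b, c)\<in>H. hat_perm \<pi> (x b) = x c)))"

definition avoiders :: "nat \<Rightarrow> arrow_pattern \<Rightarrow> nat list set" where
  "avoiders n p = {\<pi> \<in> permutations_of_set {1..n}. \<not> contains_arrow \<pi> p}"

lemma is_arrow_pattern_31_21: "is_arrow_pattern 3 ([3, 1], {(2, 1)})"
  by (auto simp: is_arrow_pattern_def pattern_letters_def)

section \<open>Bell numbers\<close>

definition Bell :: "nat \<Rightarrow> nat" where
  "Bell n = card {P. partition_on {1..n} P}"

end

theory Submission
  imports Defs
begin

text \<open>
  If \<open>hat_perm \<pi> b = a < b\<close>, then \<open>b\<close> is immediately followed by \<open>a\<close> in a block of \<open>\<pi>\<close>, since the last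
  letter of a block is mapped to the block maximum.  An occurrence of the pattern is thus a descent
  \<open>b a\<close> preceded by a letter larger than \<open>b\<close>, which means that \<open>b\<close> does not start its block.  Hence
  \<open>\<pi>\<close> avoids the pattern iff every block is its maximum followed by the other letters in
  increasing order.  Such a word is determined by the set partition formed by its blocks, and every
  set partition arises by listing the parts by increasing maximum.
\<close>

section \<open>Products of disjoint cycles\<close>

lemma cycle_of_list_next:
  "distinct (us @ b # a # vs) \<Longrightarrow> cycle_of_list (us @ b # a # vs) b = a"
proof (induction us)
  case Nil
  then show ?case by (simp add: id_outside_supp)
next
  case (Cons u us)
  obtain j cs where cs: "us @ b # a # vs = j # cs" "a \<in> set cs" by (cases us) auto
  \<comment> \<open>Prepending \<open>u\<close> composes the cycle on the left with the
    transposition of \<open>u\<close> and \<open>j\<close>, which fixes \<open>a\<close>.\<close>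
  have "a \<noteq> u" "a \<noteq> j" using Cons.prems cs by auto
  moreover have "cycle_of_list (j # cs) b = a" using Cons cs(1) by simp
  ultimately show ?case using cs(1) by (simp add: transpose_def)
qed

lemma cycle_of_list_last:
  "distinct cs \<Longrightarrow> cs \<noteq> [] \<Longrightarrow> cycle_of_list cs (last cs) = hd cs"
  by (induction cs rule: cycle_of_list.induct) auto

lemma cycle_of_list_in_set: "x \<in> set cs \<Longrightarrow> cycle_of_list cs x \<in> set cs"
  using cycle_permutes[of cs] by (simp add: permutes_in_image)

lemma foldr_cycles_outside:
  "x \<notin> set (concat bs) \<Longrightarrow> foldr (\<circ>) (map cycle_of_list bs) id x = x"
  by (induction bs) (simp_all add: id_outside_supp)

text \<open>The factors applied before that of \<open>c\<close> fix \<open>x\<close>, and those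
  applied after it fix the image of \<open>x\<close>, which is again a letter of
  \<open>c\<close>.\<close>

lemma foldr_cycles:
  assumes "distinct (concat bs)" "c \<in> set bs" "x \<in> set c"
  shows "foldr (\<circ>) (map cycle_of_list bs) id x = cycle_of_list c x"
  using assms
proof (induction bs)
  case Nil
  then show ?case by simp
next
  case (Cons d bs)
  show ?case
  proof (cases "c \<in> set bs")
    case True
    moreover from True Cons have "cycle_of_list c x \<notin> set d"
      using cycle_of_list_in_set[of x c] by auto
    ultimately show ?thesis using Cons by (simp add: id_outside_supp)
  next
    case False
    with Cons have "c = d" "x \<notin> set (concat bs)" by auto
    moreover have "foldr (\<circ>) (map cycle_of_list (d # bs)) id x =
        cycle_of_list d (foldr (\<circ>) (map cycle_of_list bs) id x)"
      by simp
    ultimately show ?thesis by (metis foldr_cycles_outside)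
  qed
qed

section \<open>The blocks of a word and the action of \<open>hat_perm\<close> on them\<close>

lemma hat_perm_block:
  assumes "distinct w" "c \<in> set (ltr_blocks w)" "x \<in> set c"
  shows "hat_perm w x = cycle_of_list c x"
  unfolding hat_perm_def using foldr_cycles[of "ltr_blocks w" c x] assms
  by (simp add: concat_ltr_blocks)

lemma set_ltr_blocks: "\<Union> (set ` set (ltr_blocks w)) = set w"
  by (metis concat_ltr_blocks set_concat)

lemma distinct_ltr_block: "distinct w \<Longrightarrow> c \<in> set (ltr_blocks w) \<Longrightarrow> distinct c"
  by (metis concat_ltr_blocks distinct_concat_iff)

lemma ltr_block_nonempty: "c \<in> set (ltr_blocks w) \<Longrightarrow> c \<noteq> []"
  using ltr_blocks_nonempty[of w] by auto

lemma tl_ltr_block_less_hd: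
  "c \<in> set (ltr_blocks w) \<Longrightarrow> y \<in> set (tl c) \<Longrightarrow> y < hd c"
  by (induction w rule: ltr_blocks.induct) (auto dest: set_takeWhileD)

lemma ltr_block_le_hd:
  assumes "c \<in> set (ltr_blocks w)" "y \<in> set c"
  shows "y \<le> hd c"
  using assms(2) tl_ltr_block_less_hd[OF assms(1), of y] by (cases c) (auto simp: less_imp_le)

lemma hat_perm_descent:
  assumes "distinct w" "b \<in> set w" "hat_perm w b < b"
  obtains us vs where "us @ b # hat_perm w b # vs \<in> set (ltr_blocks w)"
proof -
  obtain c where c: "c \<in> set (ltr_blocks w)" "b \<in> set c"
    using assms(2) set_ltr_blocks[of w] by blast
  then obtain us vs where uv: "c = us @ b # vs" by (meson split_list)
  have d: "distinct c" using distinct_ltr_block assms(1) c(1) by blast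
  have hat: "hat_perm w b = cycle_of_list c b" using hat_perm_block assms(1) c by blast
  show thesis
  proof (cases vs)
    case Nil
    then have "hat_perm w b = hd c" using hat uv d cycle_of_list_last[of c] by simp
    then show thesis using ltr_block_le_hd[OF c] assms(3) by simp
  next
    case (Cons a vs')
    then show thesis using that c uv hat d cycle_of_list_next by metis
  qed
qed

text \<open>Carries adjacency inside a block over to adjacency in the word, where the positions of
  an occurrence are measured.\<close>

lemma block_in_word:
  assumes "us @ vs \<in> set (ltr_blocks w)"
  obtains p q where "w = p @ us @ vs @ q"
proof -
  obtain bs1 bs2 where "ltr_blocks w = bs1 @ (us @ vs) # bs2"
    using assms by (meson split_list)
  then have "w = concat bs1 @ us @ vs @ concat bs2"
    by (metis append.assoc concat.simps(2) concat_append concat_ltr_blocks)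
  then show thesis using that by blast
qed

section \<open>Avoidance of the pattern in terms of blocks\<close>

lemma contains_31_21_iff:
  "contains_arrow w ([3, 1], {(2, 1)}) \<longleftrightarrow>
    (\<exists>a b c i j. a < b \<and> b < c \<and> {a, b, c} \<subseteq> {1..length w} \<and> i < j \<and> j < length w \<and>
       w ! i = c \<and> w ! j = a \<and> hat_perm w b = a)"
    (is "_ \<longleftrightarrow> ?R")
proof -
  have letters: "card (pattern_letters ([3, 1], {(2, 1)})) = 3"
    by (simp add: pattern_letters_def)
  have 3: "{1..3::nat} = {1, 2, 3}" and 2: "{..<2::nat} = {0, 1}" by auto
  have all2: "(\<forall>j<2. P j) \<longleftrightarrow> P 0 \<and> P 1" for P :: "nat \<Rightarrow> bool"
    by (auto simp: less_Suc_eq numeral_2_eq_2)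
  have unfold: "contains_arrow w ([3, 1], {(2, 1)}) \<longleftrightarrow>
    (\<exists>x t. strict_mono_on {1..3} x \<and> x ` {1..3} \<subseteq> {1..length w} \<and>
           strict_mono_on {..<2::nat} t \<and> t ` {..<2} \<subseteq> {..<length w} \<and>
           w ! t 0 = x 3 \<and> w ! t 1 = x 1 \<and> hat_perm w (x 2) = x (1::nat))"
    (is "_ \<longleftrightarrow> ?L")
    unfolding contains_arrow_def Let_def prod.case letters
    by (simp add: all2 flip: numeral_2_eq_2)
  have "?L \<longleftrightarrow> ?R"
  proof
    assume ?L
    \<comment> \<open>Only the letters 3 and 1 get positions, \<open>t 0\<close> and
      \<open>t 1\<close>. The middle value \<open>x 2\<close> is constrained by its size and its
      arrow alone.\<close>
    then obtain x and t :: "nat \<Rightarrow> nat" where *: "strict_mono_on {1..3} x" "x ` {1..3} \<subseteq> {1..length w}"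
      "strict_mono_on {..<2} t" "t ` {..<2} \<subseteq> {..<length w}"
      "w ! t 0 = x 3" "w ! t 1 = x 1" "hat_perm w (x 2) = x (1::nat)" by blast
    have "x 1 < x 2" "x 2 < x 3" "t 0 < t 1"
      using *(1,3) by (auto simp: strict_mono_on_def)
    moreover have "{x 1, x 2, x 3} \<subseteq> {1..length w}" "t 1 < length w"
      using *(2,4) unfolding 2 3 by auto
    ultimately show ?R using *(5-)
      by (intro exI[of _ "x 1"] exI[of _ "x 2"] exI[of _ "x 3"] exI[of _ "t 0"] exI[of _ "t 1"]) simp
  next
    assume ?R
    then obtain a b c i j where *: "a < b" "b < c" "{a, b, c} \<subseteq> {1..length w}"
      "i < j" "j < length w" "w ! i = c" "w ! j = a" "hat_perm w b = a" by blast
    define x where "x = (\<lambda>k::nat. if k = 1 then a else if k = 2 then b else c)"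
    define t where "t = (\<lambda>k::nat. if k = 0 then i else j)"
    have "strict_mono_on {1..3} x" "strict_mono_on {..<2} t"
      unfolding 2 3 using * by (auto simp: strict_mono_on_def x_def t_def)
    moreover have "x ` {1..3} \<subseteq> {1..length w}" "t ` {..<2} \<subseteq> {..<length w}"
      unfolding 2 3 using * by (auto simp: x_def t_def)
    ultimately show ?L using *(6-)
      by (intro exI[of _ x] exI[of _ t]) (auto simp: x_def t_def)
  qed
  with unfold show ?thesis by blast
qed

lemma avoids_31_21_iff:
  assumes w: "w \<in> permutations_of_set {1..n}"
  shows "\<not> contains_arrow w ([3, 1], {(2, 1)}) \<longleftrightarrow> (\<forall>c\<in>set (ltr_blocks w). sorted (tl c))"
proof -
  have d: "distinct w" and set_w: "set w = {1..n}"
    using w by (auto simp: permutations_of_set_def)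
  have len: "length w = n" using distinct_card[OF d] set_w by simp
  have "contains_arrow w ([3, 1], {(2, 1)}) \<longleftrightarrow> (\<exists>c\<in>set (ltr_blocks w). \<not> sorted (tl c))"
    (is "?L \<longleftrightarrow> ?R")
  proof
    assume ?L
    then obtain a b c i j where *: "a < b" "b < c" "{a, b, c} \<subseteq> {1..length w}"
      "i < j" "j < length w" "w ! i = c" "w ! j = a" "hat_perm w b = a"
      unfolding contains_31_21_iff by blast
    have "b \<in> set w" using *(3) set_w len by auto
    then obtain us vs where blk: "us @ b # a # vs \<in> set (ltr_blocks w)"
      using hat_perm_descent[OF d, of b] *(1,8) by auto
    show ?R
    proof (cases us)
      \<comment> \<open>Here \<open>b\<close> starts its block and is a left-to-right maximum. Since
        \<open>a\<close> stands right after \<open>b\<close>, the letter \<open>c\<close> before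
        \<open>a\<close> is \<open>b\<close> itself or lies to the left of \<open>b\<close>. Hence
        \<open>c\<close> \<le> \<open>b\<close>, a contradiction.\<close>
      case Nil
      then have "b \<in> hd ` set (ltr_blocks w)" using blk by force
      then have "ltr_max w b" using hd_ltr_blocks[OF d] by auto
      then obtain p q where pq: "w = p @ b # q" "\<forall>u\<in>set p. u < b"
        unfolding ltr_max_def by blast
      obtain p' q' where pq': "w = p' @ b # a # vs @ q'"
        using block_in_word[of "[]" "b # a # vs" w] blk Nil by auto
      have "w ! length p = b" "length p < length w" using pq(1) by simp_all
      moreover have "w ! length p' = b" "length p' < length w" using pq' by simp_all
      ultimately have "length p' = length p" using d nth_eq_iff_index_eq by metis
      then have "w ! Suc (length p) = a" "Suc (length p) < length w"
        using pq' by (auto simp: nth_append)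
      then have "j = Suc (length p)" using d *(5,7) nth_eq_iff_index_eq by metis
      then have "i \<le> length p" using *(4) by simp
      then have "w ! i \<in> insert b (set p)" using pq(1) by (auto simp: nth_append)
      then show ?thesis using pq(2) *(2,6) by auto
    next
      \<comment> \<open>Now \<open>b\<close> and \<open>a\<close> both lie in the tail of the block
        and form a descent there.\<close>
      case (Cons u us')
      then have "\<not> sorted (tl (us @ b # a # vs))" using *(1) by (simp add: sorted_append)
      then show ?thesis using blk by blast
    qed
  next
    assume ?R
    then obtain blk where blk: "blk \<in> set (ltr_blocks w)" "\<not> sorted (tl blk)" by blast
    then obtain k where k: "Suc k < length (tl blk)" "tl blk ! Suc k < tl blk ! k"
      unfolding sorted_iff_nth_Suc by force
    \<comment> \<open>An adjacent descent in the tail supplies the arrow from \<open>b\<close> to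
      \<open>a\<close>; the head of the block exceeds \<open>b\<close> and precedes
      \<open>a\<close>, so it plays the letter 3.\<close>
    define a b c where "a = tl blk ! Suc k" and "b = tl blk ! k" and "c = hd blk"
    define us vs where "us = take k (tl blk)" and "vs = drop (Suc (Suc k)) (tl blk)"
    have "tl blk = us @ b # a # vs"
      unfolding us_def vs_def a_def b_def using k(1)
      by (metis Cons_nth_drop_Suc Suc_lessD append_take_drop_id)
    then have blk_eq: "blk = c # us @ b # a # vs"
      using ltr_block_nonempty[OF blk(1)] unfolding c_def by (metis list.collapse)
    have "b < c" using tl_ltr_block_less_hd[OF blk(1), of b] blk_eq by simp
    obtain p q where pq: "w = p @ c # us @ b # a # vs @ q"
      using block_in_word[of "[]" blk w] blk(1) blk_eq by auto
    have "hat_perm w b = cycle_of_list blk b"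
      by (rule hat_perm_block[OF d blk(1)]) (simp add: blk_eq)
    also have "\<dots> = a"
      using cycle_of_list_next[of "c # us" b a vs] distinct_ltr_block[OF d blk(1)] blk_eq by simp
    finally have hat: "hat_perm w b = a" .
    \<comment> \<open>The summand 2 accounts for the letters \<open>c\<close> and
      \<open>b\<close>.\<close>
    define i j where "i = length p" and "j = length p + length us + 2"
    have "i < j" "j < length w" "w ! i = c" "w ! j = a"
      unfolding i_def j_def pq by (simp_all add: nth_append)
    moreover have "{a, b, c} \<subseteq> set w" using pq by simp
    ultimately show ?L
      unfolding contains_31_21_iff using hat \<open>b < c\<close> k(2) len set_w
      unfolding a_def[symmetric] b_def[symmetric] by metis
  qed
  then show ?thesis by blast
qed

section \<open>The bijection between words with sorted block tails and set partitions\<close>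

lemma sorted_hd_ltr_blocks: "distinct w \<Longrightarrow> sorted_wrt (<) (map hd (ltr_blocks w))"
proof (induction w rule: ltr_blocks.induct)
  case 1
  then show ?case by simp
next
  case (2 x xs)
  let ?ys = "dropWhile (\<lambda>y. y < x) xs"
  have sorted: "sorted_wrt (<) (map hd (ltr_blocks ?ys))"
    using 2 by (simp add: distinct_dropWhile)
  have "x < hd c" if "c \<in> set (ltr_blocks ?ys)" for c
  proof (cases ?ys)
    case Nil
    show ?thesis using that unfolding Nil by simp
  next
    case (Cons z zs)
    \<comment> \<open>The letter \<open>z\<close> ended the first block, so it is not below
      \<open>x\<close>, and distinctness excludes equality. As head of the next block,
      \<open>z\<close> is the least of the remaining heads.\<close>
    have "\<not> z < x" using hd_dropWhile[of "\<lambda>y. y < x" xs] Cons by simp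
    moreover have "z \<in> set xs" using Cons by (metis list.set_intros(1) set_dropWhileD)
    ultimately have "x < z" using 2(2) by (metis distinct.simps(2) linorder_neqE_nat)
    moreover have "z \<le> hd c"
      using sorted that unfolding Cons by (auto intro: less_imp_le)
    ultimately show ?thesis by simp
  qed
  with sorted show ?case by auto
qed

lemma partition_on_ltr_blocks:
  assumes "distinct w"
  shows "partition_on (set w) (set ` set (ltr_blocks w))"
proof (rule partition_onI)
  show "disjnt p q" if "p \<in> set ` set (ltr_blocks w)" "q \<in> set ` set (ltr_blocks w)" "p \<noteq> q" for p q
    using that assms concat_ltr_blocks[of w] distinct_concat_iff[of "ltr_blocks w"]
    by (auto simp: disjnt_def)
  show "{} \<notin> set ` set (ltr_blocks w)" using ltr_block_nonempty by auto
qed (simp add: set_ltr_blocks[simplified])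

text \<open>The letter \<open>m\<close> ends whichever block is open when it is reached, and nothing
  in \<open>zs\<close> ends the block that \<open>m\<close> opens. This lets a word be built by
  appending one block at a time.\<close>

lemma ltr_blocks_snoc:
  assumes "\<forall>u\<in>set w. u < m" "\<forall>z\<in>set zs. z < m"
  shows "ltr_blocks (w @ m # zs) = ltr_blocks w @ [m # zs]"
  using assms
proof (induction w rule: ltr_blocks.induct)
  case 1
  then have "takeWhile (\<lambda>y. y < m) zs = zs" "dropWhile (\<lambda>y. y < m) zs = []" by auto
  then show ?case by (simp del: dropWhile_eq_Nil_conv takeWhile_eq_all_conv)
next
  case (2 x xs)
  have "x < m" using 2(2) by simp
  then have "takeWhile (\<lambda>y. y < x) (xs @ m # zs) = takeWhile (\<lambda>y. y < x) xs"
    "dropWhile (\<lambda>y. y < x) (xs @ m # zs) = dropWhile (\<lambda>y. y < x) xs @ m # zs"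
    by (induction xs) auto
  then show ?case using 2 by (simp add: set_dropWhileD)
qed

text \<open>The only arrangement of a part \<open>B\<close> that can be a block of an
  avoider.\<close>

definition block_word :: "nat set \<Rightarrow> nat list" where
  "block_word B = Max B # sorted_list_of_set (B - {Max B})"

lemma block_word_set:
  assumes "distinct w" "c \<in> set (ltr_blocks w)" "sorted (tl c)"
  shows "block_word (set c) = c"
proof -
  obtain m zs where c: "c = m # zs" using ltr_block_nonempty[OF assms(2)] by (cases c) auto
  have "distinct c" using distinct_ltr_block assms(1,2) by blast
  moreover have "Max (set c) = m"
    using ltr_block_le_hd[OF assms(2)] c by (intro Max_eqI) auto
  ultimately show ?thesis
    using c assms(3) by (simp add: block_word_def sorted_list_of_set.idem_if_sorted_distinct)
qed

text \<open>Applying \<open>block_word\<close> to the parts recovers the set of blocks. Their heads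
  are strictly increasing, which fixes the order of the blocks, and concatenation returns the
  word.\<close>

lemma inj_on_ltr_partition:
  "inj_on (\<lambda>w. set ` set (ltr_blocks w)) {w. distinct w \<and> (\<forall>c\<in>set (ltr_blocks w). sorted (tl c))}"
proof (rule inj_onI, clarify)
  fix v w :: "nat list"
  assume v: "distinct v" "\<forall>c\<in>set (ltr_blocks v). sorted (tl c)"
    and w: "distinct w" "\<forall>c\<in>set (ltr_blocks w). sorted (tl c)"
    and eq: "set ` set (ltr_blocks v) = set ` set (ltr_blocks w)"
  have *: "block_word ` set ` set (ltr_blocks u) = set (ltr_blocks u)"
    if "distinct u" "\<forall>c\<in>set (ltr_blocks u). sorted (tl c)" for u
    unfolding image_image using block_word_set[OF that(1)] that(2) by simp
  have sets: "set (ltr_blocks v) = set (ltr_blocks w)"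
    by (rule trans[OF *[OF v, symmetric, unfolded eq] *[OF w]])
  have hds: "sorted (map hd (ltr_blocks u))" "distinct (map hd (ltr_blocks u))"
    if "distinct u" for u
    using sorted_hd_ltr_blocks[OF that] by (simp_all add: strict_sorted_iff)
  have "ltr_blocks v = ltr_blocks w"
  proof (rule map_sorted_distinct_set_unique[OF _ hds[OF v(1)] hds[OF w(1)] sets])
    show "inj_on hd (set (ltr_blocks v) \<union> set (ltr_blocks w))"
      using hds(2)[OF v(1)] sets by (simp add: distinct_map)
  qed
  then show "v = w" by (metis concat_ltr_blocks)
qed

text \<open>Induction adds the parts by increasing maximum, each time appending the arrangement of
  the new part to the word for the earlier ones.\<close>

lemma ltr_partition_surj:
  assumes "finite P" "disjoint P" "\<forall>B\<in>P. finite B \<and> B \<noteq> {}"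
  shows "\<exists>w. distinct w \<and> set w = \<Union>P \<and> (\<forall>c\<in>set (ltr_blocks w). sorted (tl c)) \<and>
    set ` set (ltr_blocks w) = P"
  using assms
proof (induction P rule: finite_ranking_induct[where f = Max])
  case empty
  then show ?case by (intro exI[of _ "[]"]) simp
next
  case (insert B P)
  show ?case
  \<comment> \<open>The ranking induction does not guarantee that the inserted part is new.\<close>
  proof (cases "B \<in> P")
    case True
    then show ?thesis using insert by (simp add: insert_absorb)
  next
    case False
    have "disjoint P" using insert.prems(1) by (simp add: pairwise_insert)
    then obtain w where w: "distinct w" "set w = \<Union>P" "\<forall>c\<in>set (ltr_blocks w). sorted (tl c)"
      "set ` set (ltr_blocks w) = P"
      using insert by auto
    have B: "finite B" "B \<noteq> {}" using insert.prems by auto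
    have disj: "B \<inter> \<Union>P = {}"
      using insert.prems(1) False by (auto simp: pairwise_insert disjnt_def)
    define m zs where "m = Max B" and "zs = sorted_list_of_set (B - {m})"
    have "m \<in> B" using B m_def by simp
    have set_zs: "set zs = B - {m}" using B by (simp add: zs_def)
    have "\<forall>z\<in>set zs. z < m" unfolding set_zs using B m_def by (auto simp: order_less_le)
    moreover have "\<forall>u\<in>set w. u < m"
    proof
      fix u assume "u \<in> set w"
      then obtain C where C: "C \<in> P" "u \<in> C" using w(2) by auto
      \<comment> \<open>The ranking gives \<open>u\<close> \<le> \<open>Max C\<close> \<le>
        \<open>Max B\<close>; disjointness of \<open>C\<close> and \<open>B\<close> then makes the
        inequality strict.\<close>
      then have "u \<le> m" using insert.hyps(2)[of C] insert.prems(2) m_def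
        by (meson Max_ge insertI2 order_trans)
      moreover have "u \<noteq> m" using C \<open>m \<in> B\<close> disj by auto
      ultimately show "u < m" by simp
    qed
    ultimately have blocks: "ltr_blocks (w @ m # zs) = ltr_blocks w @ [m # zs]"
      by (intro ltr_blocks_snoc)
    have set_mzs: "set (m # zs) = B" using set_zs \<open>m \<in> B\<close> by auto
    have "distinct (m # zs)" using set_zs by (simp add: zs_def)
    then have "distinct (w @ m # zs)"
      using w(1,2) set_mzs disj by (metis distinct_append inf_commute)
    moreover have "set (w @ m # zs) = \<Union> (insert B P)"
      using w(2) set_mzs by (metis Un_commute Union_insert set_append)
    moreover have "\<forall>c\<in>set (ltr_blocks (w @ m # zs)). sorted (tl c)"
      using w(3) unfolding blocks by (auto simp: zs_def)
    moreover have "set ` set (ltr_blocks (w @ m # zs)) = insert B P"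
      using w(4) set_mzs by (simp add: blocks)
    ultimately show ?thesis by blast
  qed
qed

lemma bij_betw_ltr_partition:
  assumes "finite A"
  shows "bij_betw (\<lambda>w. set ` set (ltr_blocks w))
    {w \<in> permutations_of_set A. \<forall>c\<in>set (ltr_blocks w). sorted (tl c)} {P. partition_on A P}"
    (is "bij_betw ?f ?W ?P")
proof (rule bij_betw_imageI)
  show "inj_on ?f ?W"
    by (rule inj_on_subset[OF inj_on_ltr_partition]) (auto simp: permutations_of_set_def)
  show "?f ` ?W = ?P"
  proof
    show "?f ` ?W \<subseteq> ?P"
      using partition_on_ltr_blocks by (auto simp: permutations_of_set_def)
    show "?P \<subseteq> ?f ` ?W"
    proof
      fix P assume "P \<in> ?P"
      then have P: "partition_on A P" by simp
      have "finite P" using finite_elements[OF assms P] .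
      moreover have "\<forall>B\<in>P. finite B \<and> B \<noteq> {}"
        using P assms by (metis partition_onD1 partition_onD3 Union_upper finite_subset)
      ultimately obtain w where "distinct w" "set w = \<Union>P"
        "\<forall>c\<in>set (ltr_blocks w). sorted (tl c)" "?f w = P"
        using ltr_partition_surj[of P] partition_onD2[OF P] by blast
      then show "P \<in> ?f ` ?W"
        using partition_onD1[OF P] by (auto simp: permutations_of_set_def)
    qed
  qed
qed

theorem theorem4p2:
  fixes n :: nat
  assumes "n \<ge> 1"
  shows "card (avoiders n ([3, 1], {(2, 1)})) = Bell n"
proof -
  have "avoiders n ([3, 1], {(2, 1)}) =
      {w \<in> permutations_of_set {1..n}. \<forall>c\<in>set (ltr_blocks w). sorted (tl c)}"
    unfolding avoiders_def using avoids_31_21_iff by blast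
  then show ?thesis
    unfolding Bell_def using bij_betw_same_card[OF bij_betw_ltr_partition[of "{1..n}"]] by simp
qed

end
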